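(* Let $(\mathbb{F},+,\cdot)$ be a field such that $(S,+)$ is a subsemigroup of the group $(\mathbb{F},+)$, and let $\alpha\in\mathbb{F}$ be arbitrarily fixed. If a function $f\colon S\to\mathbb{F}$ satisfies \[ f(x+y)-f(x)-f(y)=\alpha xy\qquad\text{for all } x,y\in S, \] then there exists an additive function $a\colon S\to\mathbb{F}$ (i.e. $a(x+y)=a(x)+a(y)$ for all $x,y\in S$) such that \[ f(x)=\frac{\alpha}{2}x^{2}+a(x)\qquad\text{for all } x\in S. \] *)

theory Defs imports Main begin

text \<open>The empty set is admitted as a subsemigroup. Functions on \<open>S\<close> are represented by total
  functions, whose values outside \<open>S\<close> are irrelevant.\<close>

definition add_subsemigroup :: "'a::semigroup_add set \<Rightarrow> bool" where
  "add_subsemigroup S \<longleftrightarrow> (\<forall>x\<in>S. \<forall>y\<in>S. x + y \<in> S)"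

definition additive_on :: "'a::semigroup_add set \<Rightarrow> ('a \<Rightarrow> 'b::semigroup_add) \<Rightarrow> bool" where
  "additive_on S a \<longleftrightarrow> (\<forall>x\<in>S. \<forall>y\<in>S. a (x + y) = a x + a y)"

end

theory Submission imports Defs begin

text \<open>Away from characteristic 2 subtract the quadratic part, as
  \<open>(x + y)\<^sup>2 - x\<^sup>2 - y\<^sup>2 = 2 * x * y\<close>. In characteristic 2 the term \<open>\<alpha> / 2\<close> is \<open>0\<close>, so \<open>f\<close>
  itself has to be additive: since \<open>x + x = 0\<close>, the equation at \<open>(x, x)\<close> and \<open>(0, 0)\<close> gives
  \<open>\<alpha> * x\<^sup>2 = f 0 = 0\<close>, so \<open>\<alpha> = 0\<close> or \<open>S \<subseteq> {0}\<close>.\<close>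

theorem corollary1:
  fixes S :: "'a::field set" and \<alpha> :: 'a and f :: "'a \<Rightarrow> 'a"
  assumes "add_subsemigroup S"
    and "\<And>x y. x \<in> S \<Longrightarrow> y \<in> S \<Longrightarrow> f (x + y) - f x - f y = \<alpha> * x * y"
  shows "\<exists>a :: 'a \<Rightarrow> 'a. additive_on S a \<and> (\<forall>x\<in>S. f x = \<alpha> / 2 * x\<^sup>2 + a x)"
proof -
  have eq: "f (x + y) = f x + f y + \<alpha> * x * y" if "x \<in> S" "y \<in> S" for x y
    using assms(2)[OF that] by (simp add: algebra_simps)
  \<comment> \<open>The cross term of the square must match the defect of \<open>f\<close>; only
    this identity depends on the characteristic.\<close>
  have half: "\<alpha> / 2 * (2 * x * y) = \<alpha> * x * y" if "x \<in> S" "y \<in> S" for x y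
  proof (cases "(2 :: 'a) = 0")
    case True
    have double: "z + z = 0" for z :: 'a
      using True by (metis mult_2 mult_zero_left)
    have "0 \<in> S"
      using assms(1) \<open>x \<in> S\<close> double[of x] unfolding add_subsemigroup_def by metis
    then have "f 0 = 0"
      using eq[of 0 0] double[of "f 0"] by simp
    then have "\<alpha> * x * x = 0"
      using eq[OF \<open>x \<in> S\<close> \<open>x \<in> S\<close>] double[of x] double[of "f x"] by simp
    \<comment> \<open>The left side vanishes because 2 = 0, the right side because
      \<open>\<alpha> = 0\<close> or \<open>x = 0\<close>.\<close>
    then show ?thesis
      using True by auto
  next
    case False
    then show ?thesis by simp
  qed
  define a where "a x = f x - \<alpha> / 2 * x\<^sup>2" for x
  have "a (x + y) = a x + a y" if "x \<in> S" "y \<in> S" for x y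
  proof -
    \<comment> \<open>The product \<open>2 * x * y\<close> is kept whole so that \<open>half\<close>
      rewrites the last summand in any characteristic.\<close>
    have "\<alpha> / 2 * (x + y)\<^sup>2 = \<alpha> / 2 * x\<^sup>2 + \<alpha> / 2 * y\<^sup>2 + \<alpha> / 2 * (2 * x * y)"
      by (simp only: power2_sum distrib_left)
    then show ?thesis
      unfolding a_def eq[OF that] half[OF that] by (simp only: algebra_simps)
  qed
  then have "additive_on S a"
    by (simp add: additive_on_def)
  moreover have "\<forall>x\<in>S. f x = \<alpha> / 2 * x\<^sup>2 + a x"
    by (simp add: a_def)
  ultimately show ?thesis by blast
qed

end
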